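(* Monotonic GNNs have exactly the same expressive power as $\exists^+\mathcal{GML}$: for every monotonic GNN $\mathcal{N}$ of dimension $d$ there is an $\exists^+\mathcal{GML}$ formula $\varphi$ over $\mathsf{PROP}=\{p_1,\dots,p_d\}$ such that for all pointed graphs $(G,v)$ of dimension $d$, $\mathcal{N}(G,v)=\mathsf{true}$ iff $(\mathfrak{M}_G,v)\models\varphi$; and conversely, for every $\exists^+\mathcal{GML}$ formula $\varphi$ over $\{p_1,\dots,p_d\}$ there is a monotonic GNN $\mathcal{N}$ of dimension $d$ with the same property.
   Context: Graphs are finite, undirected, simple, node-labelled $G=(V,E,\lambda)$ with $\lambda:V\to\{0,1\}^d$ ($d$ the dimension); a pointed graph is $(G,v)$ with $v\in V$. $G$ corresponds to the Kripke model $\mathfrak{M}_G$ with worlds $V$, accessibility $\{(u,w):\{u,w\}\in E\}$, and $p_i$ true at $u$ iff the $i$-th entry of $\lambda(u)$ is $1$. A GNN of dimension $d$ with $L$ layers consists of layers $(\mathsf{agg}_\ell,\mathsf{comb}_\ell)$, $\ell=1,\dots,L$, where $\mathsf{agg}_\ell$ maps finite multisets of vectors in $\mathbb{R}^{d_{\ell-1}}$ to vectors in $\mathbb{R}^{d'_\ell}$ and $\mathsf{comb}_\ell:\mathbb{R}^{d_{\ell-1}+d'_\ell}\to\mathbb{R}^{d_\ell}$ ($d_0=d$), and a classification function $\mathsf{cls}:\mathbb{R}^{d_L}\to\{\mathsf{false},\mathsf{true}\}$. On $G$: $\lambda^{(0)}=\lambda$ and $\lambda^{(\ell)}(v)=\mathsf{comb}_\ell(\lambda^{(\ell-1)}(v),\mathsf{agg}_\ell(\{\!\{\lambda^{(\ell-1)}(w):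 \{v,w\}\in E\}\!\}))$; $\mathcal{N}(G,v)=\mathsf{cls}(\lambda^{(L)}(v))$. For vectors, $\mathbf{x}\le\mathbf{x}'$ means componentwise $\le$; for multisets $M\le M'$ iff there is an injection $f:M\to M'$ with $\mathbf{x}\le f(\mathbf{x})$ for all $\mathbf{x}\in M$; on truth values $\mathsf{false}\le\mathsf{true}$. A function is non-decreasing if $x\le y$ implies $f(x)\le f(y)$ (and, for combination functions, on concatenated vectors componentwise). A GNN is monotonic if all its aggregation functions, combination functions and its classification function are non-decreasing. $\mathcal{GML}$: $\varphi::=p\mid\neg\varphi\mid\varphi\wedge\varphi\mid\varphi\vee\varphi\mid\Diamond^{\ge k}\varphi$ ($k\ge1$), $(\mathfrak{M},w)\models\Diamond^{\ge k}\varphi$ iff at least $k$ successors of $w$ satisfy $\varphi$; $\exists^+\mathcal{GML}$ is its negation-free fragment.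
   Formalization: The negation-free fragment is taken with the truth constants ⊤ and ⊥, since without them constant GNNs (which are monotonic) have no equivalent formula; graphs have nodes from one arbitrary fixed set (e.g. the naturals, covering all finite graphs up to isomorphism). *)

theory Defs
  imports "Jordan_Normal_Form.Matrix" "HOL-Library.Multiset"
begin

section \<open>Labelled graphs\<close>

text \<open>Edges are unordered pairs; labels are real 0/1-vectors, so that they can be fed
  directly into a GNN.\<close>

record 'v lgraph =
  nodes :: "'v set"
  edges :: "'v set set"
  lab :: "'v \<Rightarrow> real vec"

definition is_lgraph :: "nat \<Rightarrow> 'v lgraph \<Rightarrow> bool" where
  "is_lgraph d G \<longleftrightarrow>
     finite (nodes G) \<and>
     (\<forall>e \<in> edges G. e \<subseteq> nodes G \<and> card e = 2) \<and>
     (\<forall>v \<in> nodes G. lab G v \<in> carrier_vec d \<and> (\<forall>i < d. lab G v $ i \<in> {0, 1}))"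

definition pointed_lgraph :: "nat \<Rightarrow> 'v lgraph \<Rightarrow> 'v \<Rightarrow> bool" where
  "pointed_lgraph d G v \<longleftrightarrow> is_lgraph d G \<and> v \<in> nodes G"


section \<open>Graph neural networks\<close>

text \<open>Layers are numbered from 1 to \<open>gnn_depth\<close>; layer \<open>l\<close> maps vectors of dimension
  \<open>gnn_dim (l - 1)\<close> to vectors of dimension \<open>gnn_dim l\<close>, and its aggregation function
  has output dimension \<open>gnn_agg_dim l\<close>. A combination function takes the concatenation
  of its two arguments.\<close>

record gnn =
  gnn_depth :: nat
  gnn_dim :: "nat \<Rightarrow> nat"
  gnn_agg_dim :: "nat \<Rightarrow> nat"
  gnn_agg :: "nat \<Rightarrow> real vec multiset \<Rightarrow> real vec"
  gnn_comb :: "nat \<Rightarrow> real vec \<Rightarrow> real vec"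
  gnn_cls :: "real vec \<Rightarrow> bool"

definition vec_msets :: "nat \<Rightarrow> real vec multiset set" where
  "vec_msets n = {M. set_mset M \<subseteq> carrier_vec n}"

definition is_gnn :: "nat \<Rightarrow> gnn \<Rightarrow> bool" where
  "is_gnn d N \<longleftrightarrow>
     gnn_dim N 0 = d \<and>
     (\<forall>l \<in> {1..gnn_depth N}.
        gnn_agg N l \<in> vec_msets (gnn_dim N (l - 1)) \<rightarrow> carrier_vec (gnn_agg_dim N l) \<and>
        gnn_comb N l \<in> carrier_vec (gnn_dim N (l - 1) + gnn_agg_dim N l)
                         \<rightarrow> carrier_vec (gnn_dim N l))"

primrec gnn_lab :: "gnn \<Rightarrow> 'v lgraph \<Rightarrow> nat \<Rightarrow> 'v \<Rightarrow> real vec" where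
  "gnn_lab N G 0 v = lab G v"
| "gnn_lab N G (Suc l) v =
     gnn_comb N (Suc l)
       (gnn_lab N G l v @\<^sub>v
        gnn_agg N (Suc l) (image_mset (gnn_lab N G l) (mset_set {w. {v, w} \<in> edges G})))"

definition gnn_run :: "gnn \<Rightarrow> 'v lgraph \<Rightarrow> 'v \<Rightarrow> bool" where
  "gnn_run N G v \<longleftrightarrow> gnn_cls N (gnn_lab N G (gnn_depth N) v)"

text \<open>An injection between multisets is an injection between their sets of occurrences:
  \<open>(x, i)\<close> with \<open>i < count M x\<close> is the \<open>i\<close>-th copy of \<open>x\<close> in \<open>M\<close>.\<close>

definition occs :: "'a multiset \<Rightarrow> ('a \<times> nat) set" where
  "occs M = {(x, i). i < count M x}"

definition mset_le :: "'a::ord multiset \<Rightarrow> 'a multiset \<Rightarrow> bool" where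
  "mset_le M M' \<longleftrightarrow>
     (\<exists>f. f \<in> occs M \<rightarrow> occs M' \<and> inj_on f (occs M) \<and> (\<forall>p \<in> occs M. fst p \<le> fst (f p)))"

text \<open>The library order on \<open>real vec\<close> is the componentwise one between vectors of equal
  dimension.\<close>

definition monotonic_gnn :: "gnn \<Rightarrow> bool" where
  "monotonic_gnn N \<longleftrightarrow>
     (\<forall>l \<in> {1..gnn_depth N}.
        monotone_on (vec_msets (gnn_dim N (l - 1))) mset_le (\<le>) (gnn_agg N l) \<and>
        mono_on (carrier_vec (gnn_dim N (l - 1) + gnn_agg_dim N l)) (gnn_comb N l)) \<and>
     mono_on (carrier_vec (gnn_dim N (gnn_depth N))) (gnn_cls N)"


section \<open>Graded modal logic\<close>

record 'v kripke =
  worlds :: "'v set"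
  access :: "('v \<times> 'v) set"
  holds :: "nat \<Rightarrow> 'v \<Rightarrow> bool"

text \<open>Vector entries are indexed from 0, propositions from 1.\<close>

definition kripke_of :: "'v lgraph \<Rightarrow> 'v kripke" where
  "kripke_of G =
     \<lparr>worlds = nodes G,
      access = {(u, w). {u, w} \<in> edges G},
      holds = (\<lambda>i u. lab G u $ (i - 1) = 1)\<rparr>"

text \<open>The constants are atoms here because they are not definable from propositions
  without negation. The negation-free fragment needs both of them: without \<open>Bot\<close> every
  negation-free formula holds at a node of a large enough complete graph with all labels 1,
  and without \<open>Top\<close> none holds at an isolated node with label 0, so the two constant
  GNNs (which are monotonic) would have no equivalent formula.\<close>

datatype gml =
    Prop nat
  | Top
  | Bot
  | Neg gml
  | Conj gml gml
  | Disj gml gml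
  | Dia nat gml

primrec gml_over :: "nat \<Rightarrow> gml \<Rightarrow> bool" where
  "gml_over d (Prop i) \<longleftrightarrow> i \<in> {1..d}"
| "gml_over d Top \<longleftrightarrow> True"
| "gml_over d Bot \<longleftrightarrow> True"
| "gml_over d (Neg \<phi>) \<longleftrightarrow> gml_over d \<phi>"
| "gml_over d (Conj \<phi> \<psi>) \<longleftrightarrow> gml_over d \<phi> \<and> gml_over d \<psi>"
| "gml_over d (Disj \<phi> \<psi>) \<longleftrightarrow> gml_over d \<phi> \<and> gml_over d \<psi>"
| "gml_over d (Dia k \<phi>) \<longleftrightarrow> k \<ge> 1 \<and> gml_over d \<phi>"

primrec neg_free :: "gml \<Rightarrow> bool" where
  "neg_free (Prop i) \<longleftrightarrow> True"
| "neg_free Top \<longleftrightarrow> True"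
| "neg_free Bot \<longleftrightarrow> True"
| "neg_free (Neg \<phi>) \<longleftrightarrow> False"
| "neg_free (Conj \<phi> \<psi>) \<longleftrightarrow> neg_free \<phi> \<and> neg_free \<psi>"
| "neg_free (Disj \<phi> \<psi>) \<longleftrightarrow> neg_free \<phi> \<and> neg_free \<psi>"
| "neg_free (Dia k \<phi>) \<longleftrightarrow> neg_free \<phi>"

definition ex_pos_gml :: "nat \<Rightarrow> gml set" where
  "ex_pos_gml d = {\<phi>. gml_over d \<phi> \<and> neg_free \<phi>}"

primrec sat :: "'v kripke \<Rightarrow> 'v \<Rightarrow> gml \<Rightarrow> bool" where
  "sat M w (Prop i) \<longleftrightarrow> holds M i w"
| "sat M w Top \<longleftrightarrow> True"
| "sat M w Bot \<longleftrightarrow> False"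
| "sat M w (Neg \<phi>) \<longleftrightarrow> \<not> sat M w \<phi>"
| "sat M w (Conj \<phi> \<psi>) \<longleftrightarrow> sat M w \<phi> \<and> sat M w \<psi>"
| "sat M w (Disj \<phi> \<psi>) \<longleftrightarrow> sat M w \<phi> \<or> sat M w \<psi>"
| "sat M w (Dia k \<phi>) \<longleftrightarrow>
     (\<exists>U. finite U \<and> card U = k \<and> (\<forall>u \<in> U. (w, u) \<in> access M \<and> sat M u \<phi>))"

end

theory Submission
  imports Defs "HOL-Library.Ramsey"
begin

text \<open>A monotonic GNN with \<open>L\<close> layers is monotone for the depth-\<open>L\<close> graded simulation
  preorder (each node's neighbours are mapped injectively to simulating neighbours). By
  Higman's lemma this preorder on pointed graphs of dimension \<open>d\<close> is a well-quasi-order, so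
  the accepted pointed graphs are the upward closure of finitely many of them. The upward
  closure of one pointed graph is definable by a negation-free formula: by Hall's theorem
  the injection exists iff for every set \<open>S\<close> of neighbours at least \<open>|S|\<close> nodes
  simulate some member of \<open>S\<close>. Conversely, a GNN evaluates a formula by
  computing the truth values of its subformulas one layer at a time.\<close>


section \<open>Almost full relations and minimal bad sequences\<close>

definition bad_seq :: "('a \<Rightarrow> 'a \<Rightarrow> bool) \<Rightarrow> 'a set \<Rightarrow> (nat \<Rightarrow> 'a) \<Rightarrow> bool" where
  "bad_seq P A f \<longleftrightarrow> (\<forall>n. f n \<in> A) \<and> (\<forall>i j. i < j \<longrightarrow> \<not> P (f i) (f j))"

definition almost_full_on :: "('a \<Rightarrow> 'a \<Rightarrow> bool) \<Rightarrow> 'a set \<Rightarrow> bool" where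
  "almost_full_on P A \<longleftrightarrow> (\<forall>f. \<not> bad_seq P A f)"

lemma almost_full_onI:
  assumes "\<And>f :: nat \<Rightarrow> 'a. (\<And>n. f n \<in> A) \<Longrightarrow> \<exists>i j. i < j \<and> P (f i) (f j)"
  shows "almost_full_on P A"
  unfolding almost_full_on_def bad_seq_def using assms by blast

lemma almost_full_onE:
  assumes "almost_full_on P A" and "\<And>n :: nat. f n \<in> A"
  obtains i j where "i < j" and "P (f i) (f j)"
  using assms unfolding almost_full_on_def bad_seq_def by blast

lemma almost_full_on_subset:
  assumes "almost_full_on P B" and "A \<subseteq> B"
  shows "almost_full_on P A"
  using assms unfolding almost_full_on_def bad_seq_def by blast

lemma almost_full_on_vimage:
  assumes "almost_full_on P B" and "h \<in> A \<rightarrow> B"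
  shows "almost_full_on (\<lambda>x y. P (h x) (h y)) A"
proof (rule almost_full_onI)
  fix f :: "nat \<Rightarrow> 'b"
  assume "\<And>n. f n \<in> A"
  then have "h (f n) \<in> B" for n
    using assms(2) by auto
  then obtain i j where "i < j" "P (h (f i)) (h (f j))"
    by (rule almost_full_onE[OF assms(1)])
  then show "\<exists>i j. i < j \<and> P (h (f i)) (h (f j))"
    by blast
qed

lemma almost_full_on_finite:
  assumes "finite A" and "reflp_on A P"
  shows "almost_full_on P A"
proof (rule almost_full_onI)
  fix f :: "nat \<Rightarrow> 'a"
  assume f: "\<And>n. f n \<in> A"
  then have "finite (range f)"
    using \<open>finite A\<close> by (meson finite_subset image_subsetI)
  then have "\<not> inj f"
    using finite_imageD infinite_UNIV_nat by blast
  then obtain i j where "i < j" "f i = f j"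
    by (metis injI linorder_neqE_nat)
  then show "\<exists>i j. i < j \<and> P (f i) (f j)"
    using f \<open>reflp_on A P\<close> by (metis reflp_onD)
qed

lemma almost_full_on_homogeneous_subseq:
  assumes af: "almost_full_on P A" and f: "\<And>n. f n \<in> A"
  obtains r :: "nat \<Rightarrow> nat" where "strict_mono r" and "\<And>i j. i < j \<Longrightarrow> P (f (r i)) (f (r j))"
proof -
  define colour where "colour X = (if P (f (Min X)) (f (Max X)) then 0 else 1 :: nat)" for X
  have "\<exists>Y t. Y \<subseteq> UNIV \<and> infinite Y \<and> t < 2 \<and> (\<forall>x\<in>Y. \<forall>y\<in>Y. x \<noteq> y \<longrightarrow> colour {x, y} = t)"
    by (rule Ramsey2) (auto simp: colour_def)
  then obtain Y t where "infinite Y" and colour: "\<forall>x\<in>Y. \<forall>y\<in>Y. x \<noteq> y \<longrightarrow> colour {x, y} = t"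
    by (elim exE conjE)
  define r where "r = enumerate Y"
  have r: "strict_mono r" "r n \<in> Y" for n
    using \<open>infinite Y\<close> by (simp_all add: r_def strict_mono_enumerate enumerate_in_set)
  have P_iff: "P (f (r i)) (f (r j)) \<longleftrightarrow> t = 0" if "i < j" for i j
  proof -
    have "r i < r j"
      using strict_monoD[OF r(1) that] .
    then have "colour {r i, r j} = t" "Min {r i, r j} = r i" "Max {r i, r j} = r j"
      using colour r(2) by auto
    then show ?thesis
      by (simp add: colour_def split: if_splits)
  qed
  moreover obtain i j where "i < j" "P (f (r i)) (f (r j))"
    by (rule almost_full_onE[OF af, of "\<lambda>n. f (r n)"]) (use f in auto)
  ultimately have "t = 0"
    by blast
  then show thesis
    using that r(1) P_iff by blast
qed

lemma almost_full_on_conj: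
  assumes "almost_full_on P A" and "almost_full_on Q A"
  shows "almost_full_on (\<lambda>x y. P x y \<and> Q x y) A"
proof (rule almost_full_onI)
  fix f :: "nat \<Rightarrow> 'a"
  assume f: "\<And>n. f n \<in> A"
  obtain r :: "nat \<Rightarrow> nat" where r: "strict_mono r" "\<And>i j. i < j \<Longrightarrow> P (f (r i)) (f (r j))"
    using almost_full_on_homogeneous_subseq[of P A f, OF assms(1) f] by metis
  obtain i j where "i < j" "Q (f (r i)) (f (r j))"
    by (rule almost_full_onE[OF assms(2), of "\<lambda>n. f (r n)"]) (use f in auto)
  then show "\<exists>i j. i < j \<and> P (f i) (f j) \<and> Q (f i) (f j)"
    using r strict_monoD[OF r(1)] by blast
qed

lemma almost_full_on_finite_basis:
  assumes "almost_full_on P A"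
  shows "\<exists>B. finite B \<and> B \<subseteq> A \<and> (\<forall>x\<in>A. \<exists>b\<in>B. P b x)"
proof (rule ccontr)
  assume no_basis: "\<not> ?thesis"
  have "\<exists>f. \<forall>n :: nat. f n \<in> A \<and> (\<forall>i<n. \<not> P (f i) (f n))"
  proof (rule dependent_wellorder_choice)
    fix n :: nat and f
    assume "\<And>i. i < n \<Longrightarrow> f i \<in> A \<and> (\<forall>k<i. \<not> P (f k) (f i))"
    then have "finite (f ` {..<n})" "f ` {..<n} \<subseteq> A"
      by auto
    with no_basis have "\<not> (\<forall>x\<in>A. \<exists>b\<in>f ` {..<n}. P b x)"
      by blast
    then show "\<exists>x. x \<in> A \<and> (\<forall>i<n. \<not> P (f i) x)"
      by auto
  qed simp
  then obtain f where "\<forall>n :: nat. f n \<in> A \<and> (\<forall>i<n. \<not> P (f i) (f n))" ..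
  then have "bad_seq P A f"
    by (simp add: bad_seq_def)
  with assms show False
    by (simp add: almost_full_on_def)
qed

lemma ex_has_least_wellorder:
  fixes \<mu> :: "'a \<Rightarrow> 'b::wellorder"
  assumes "Q x"
  shows "\<exists>y. Q y \<and> (\<forall>z. Q z \<longrightarrow> \<mu> y \<le> \<mu> z)"
proof -
  let ?least = "LEAST m. \<exists>y. Q y \<and> \<mu> y = m"
  have "\<exists>y. Q y \<and> \<mu> y = ?least"
    by (rule LeastI_ex) (use assms in blast)
  moreover have "?least \<le> \<mu> z" if "Q z" for z
    by (rule Least_le) (use that in blast)
  ultimately show ?thesis
    by metis
qed

definition minimal_bad_seq ::
    "('a \<Rightarrow> 'b::wellorder) \<Rightarrow> ('a \<Rightarrow> 'a \<Rightarrow> bool) \<Rightarrow> 'a set \<Rightarrow> (nat \<Rightarrow> 'a) \<Rightarrow> bool" where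
  "minimal_bad_seq \<mu> P A m \<longleftrightarrow> bad_seq P A m \<and>
     (\<forall>n h. bad_seq P A h \<and> (\<forall>i<n. h i = m i) \<longrightarrow> \<mu> (m n) \<le> \<mu> (h n))"

lemma ex_greedy_seq:
  fixes \<mu> :: "'a \<Rightarrow> 'b::wellorder" and f :: "nat \<Rightarrow> 'a"
  assumes "f \<in> F"
  obtains m where "\<And>n. \<exists>h\<in>F. \<forall>i\<le>n. h i = m i"
    and "\<And>n h. h \<in> F \<Longrightarrow> \<forall>i<n. h i = m i \<Longrightarrow> \<mu> (m n) \<le> \<mu> (h n)"
proof -
  define extends where "extends m n h \<longleftrightarrow> h \<in> F \<and> (\<forall>i<n. h i = m i)" for m n h
  define best where "best m n x \<longleftrightarrow>
    (\<exists>h. extends m n h \<and> h n = x) \<and> (\<forall>h. extends m n h \<longrightarrow> \<mu> x \<le> \<mu> (h n))" for m n x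
  have "\<exists>m. \<forall>n. best m n (m n)"
  proof (rule dependent_wellorder_choice)
    show "best m n x \<longleftrightarrow> best m' n x" if "\<And>i. i < n \<Longrightarrow> m i = m' i" for m m' n x
      using that by (simp add: best_def extends_def)
  next
    fix n m
    assume prefix: "\<And>i. i < n \<Longrightarrow> best m i (m i)"
    have "\<exists>h. extends m n h"
    proof (cases n)
      case 0
      then show ?thesis
        using assms by (auto simp: extends_def)
    next
      case (Suc k)
      then obtain h where "extends m k h" "h k = m k"
        using prefix[of k] unfolding best_def by blast
      then show ?thesis
        using Suc by (auto simp: extends_def less_Suc_eq)
    qed
    then obtain h where "extends m n h" "\<forall>h'. extends m n h' \<longrightarrow> \<mu> (h n) \<le> \<mu> (h' n)"
      using ex_has_least_wellorder[of "extends m n" _ "\<lambda>h. \<mu> (h n)"] by blast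
    then show "\<exists>x. best m n x"
      unfolding best_def by blast
  qed
  then obtain m where best: "\<And>n. best m n (m n)"
    by blast
  show thesis
  proof (rule that)
    show "\<exists>h\<in>F. \<forall>i\<le>n. h i = m i" for n
      using best[of n] unfolding best_def extends_def by (metis le_less)
    show "\<mu> (m n) \<le> \<mu> (h n)" if "h \<in> F" "\<forall>i<n. h i = m i" for n h
      using best[of n] that by (simp add: best_def extends_def)
  qed
qed

lemma ex_minimal_bad_seq:
  fixes \<mu> :: "'a \<Rightarrow> 'b::wellorder"
  assumes "bad_seq P A f"
  shows "\<exists>m. minimal_bad_seq \<mu> P A m"
proof -
  obtain m where prefix: "\<And>n. \<exists>h\<in>{h. bad_seq P A h}. \<forall>i\<le>n. h i = m i"
    and least: "\<And>n h. h \<in> {h. bad_seq P A h} \<Longrightarrow> \<forall>i<n. h i = m i \<Longrightarrow> \<mu> (m n) \<le> \<mu> (h n)"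
    using ex_greedy_seq[of f "{h. bad_seq P A h}" \<mu>] assms by blast
  have "m n \<in> A" for n
    using prefix[of n] by (metis bad_seq_def mem_Collect_eq order_refl)
  moreover have "\<not> P (m i) (m j)" if "i < j" for i j
    using prefix[of j] that by (metis bad_seq_def less_imp_le mem_Collect_eq order_refl)
  ultimately have "bad_seq P A m"
    by (simp add: bad_seq_def)
  then show ?thesis
    using least by (auto simp: minimal_bad_seq_def)
qed

lemma bad_seq_splice:
  assumes m: "bad_seq P A m" and s: "bad_seq P A s"
    and up: "\<And>x i. x \<in> A \<Longrightarrow> P x (s i) \<Longrightarrow> \<exists>j\<ge>k. P x (m j)"
  shows "bad_seq P A (\<lambda>i. if i < k then m i else s (i - k))"
  unfolding bad_seq_def
proof (intro conjI allI impI)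
  show "(if n < k then m n else s (n - k)) \<in> A" for n
    using m s by (simp add: bad_seq_def)
next
  fix i j :: nat
  assume "i < j"
  consider (left) "j < k" | (across) "i < k" "k \<le> j" | (right) "k \<le> i"
    by linarith
  then show "\<not> P (if i < k then m i else s (i - k)) (if j < k then m j else s (j - k))"
  proof cases
    case left
    then show ?thesis
      using \<open>i < j\<close> m by (simp add: bad_seq_def)
  next
    case across
    have "\<not> P (m i) (m j')" if "j' \<ge> k" for j'
      using m across(1) that by (simp add: bad_seq_def)
    then have "\<not> P (m i) (s (j - k))"
      using up[of "m i" "j - k"] m by (auto simp: bad_seq_def)
    with across show ?thesis
      by simp
  next
    case right
    then show ?thesis
      using \<open>i < j\<close> s by (simp add: bad_seq_def diff_less_mono)
  qed
qed

lemma minimal_bad_seq_good_below: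
  fixes r :: "nat \<Rightarrow> nat"
  assumes min: "minimal_bad_seq \<mu> P A m" and r: "strict_mono r"
    and smaller: "\<And>n. s n \<in> A" "\<And>n. \<mu> (s n) < \<mu> (m n)"
    and up: "\<And>x n. x \<in> A \<Longrightarrow> P x (s n) \<Longrightarrow> P x (m n)"
  shows "\<exists>i j. i < j \<and> P (s (r i)) (s (r j))"
proof (rule ccontr)
  assume "\<not> ?thesis"
  then have "bad_seq P A (\<lambda>i. s (r i))"
    using smaller(1) by (auto simp: bad_seq_def)
  moreover have "bad_seq P A m"
    using min by (simp add: minimal_bad_seq_def)
  moreover have "\<exists>j\<ge>r 0. P x (m j)" if "x \<in> A" "P x (s (r i))" for x i
    using up[OF that] strict_mono_less_eq[OF r, of 0 i] by auto
  ultimately have "bad_seq P A (\<lambda>i. if i < r 0 then m i else s (r (i - r 0)))"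
    (is "bad_seq P A ?h")
    using bad_seq_splice[of P A m "\<lambda>i. s (r i)" "r 0"] by blast
  moreover have "\<forall>i<r 0. ?h i = m i"
    by simp
  ultimately have "\<mu> (m (r 0)) \<le> \<mu> (?h (r 0))"
    using min unfolding minimal_bad_seq_def by blast
  also have "\<dots> < \<mu> (m (r 0))"
    using smaller(2) by simp
  finally show False
    by simp
qed


section \<open>Embeddings of sets and Higman's lemma\<close>

definition set_emb :: "('a \<Rightarrow> 'b \<Rightarrow> bool) \<Rightarrow> 'a set \<Rightarrow> 'b set \<Rightarrow> bool" where
  "set_emb P A B \<longleftrightarrow> (\<exists>f. inj_on f A \<and> (\<forall>a\<in>A. f a \<in> B \<and> P a (f a)))"

lemma set_emb_empty [simp]: "set_emb P {} B"
  by (simp add: set_emb_def)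

lemma set_emb_mono:
  assumes "set_emb P A B" and "B \<subseteq> C" and "\<And>a b. a \<in> A \<Longrightarrow> b \<in> B \<Longrightarrow> P a b \<Longrightarrow> Q a b"
  shows "set_emb Q A C"
  using assms unfolding set_emb_def by (meson subsetD)

lemma set_emb_remove:
  assumes "set_emb P (A - {a}) (B - {b})" and "P a b" and "b \<in> B"
  shows "set_emb P A B"
proof -
  obtain f where "inj_on f (A - {a})" "\<forall>x\<in>A - {a}. f x \<in> B - {b} \<and> P x (f x)"
    using assms(1) by (auto simp: set_emb_def)
  then have "inj_on (f(a := b)) A" "\<forall>x\<in>A. (f(a := b)) x \<in> B \<and> P x ((f(a := b)) x)"
    using assms(2,3) by (auto simp: inj_on_def)
  then show ?thesis
    unfolding set_emb_def by blast
qed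

lemma set_emb_trans:
  assumes "set_emb P A B" and "set_emb Q B C"
  shows "set_emb (P OO Q) A C"
proof -
  obtain f g where "inj_on f A" "\<forall>a\<in>A. f a \<in> B \<and> P a (f a)"
    and "inj_on g B" "\<forall>b\<in>B. g b \<in> C \<and> Q b (g b)"
    using assms by (auto simp: set_emb_def)
  then have "inj_on (g \<circ> f) A" "\<forall>a\<in>A. (g \<circ> f) a \<in> C \<and> (P OO Q) a ((g \<circ> f) a)"
    by (auto simp: inj_on_def)
  then show ?thesis
    unfolding set_emb_def by blast
qed

lemma set_emb_card_filter_mono:
  assumes "set_emb P A B" and "finite B"
    and "\<And>a b. a \<in> A \<Longrightarrow> b \<in> B \<Longrightarrow> P a b \<Longrightarrow> Q a \<Longrightarrow> R b"
  shows "card {a \<in> A. Q a} \<le> card {b \<in> B. R b}"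
proof -
  obtain f where f: "inj_on f A" "\<forall>a\<in>A. f a \<in> B \<and> P a (f a)"
    using assms(1) by (auto simp: set_emb_def)
  show ?thesis
  proof (rule card_inj_on_le)
    show "inj_on f {a \<in> A. Q a}"
      using f(1) by (rule inj_on_subset) simp
    show "f ` {a \<in> A. Q a} \<subseteq> {b \<in> B. R b}"
      using f(2) assms(3) by blast
  qed (use \<open>finite B\<close> in simp)
qed

theorem almost_full_on_set_emb:
  assumes "almost_full_on P A"
  shows "almost_full_on (set_emb P) (Fpow A)"
proof (rule ccontr)
  assume "\<not> ?thesis"
  then obtain X where min: "minimal_bad_seq card (set_emb P) (Fpow A) X"
    unfolding almost_full_on_def using ex_minimal_bad_seq by blast
  then have X: "X n \<subseteq> A" "finite (X n)" and bad: "i < j \<Longrightarrow> \<not> set_emb P (X i) (X j)" for i j n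
    by (simp_all add: minimal_bad_seq_def bad_seq_def Fpow_def)
  have "X n \<noteq> {}" for n
    using bad[of n "Suc n"] by auto
  then have "\<forall>n. \<exists>a. a \<in> X n"
    by blast
  then obtain x where x: "\<And>n. x n \<in> X n"
    by metis
  have "x n \<in> A" for n
    using x X(1) by blast
  then obtain r :: "nat \<Rightarrow> nat"
    where r: "strict_mono r" and heads: "\<And>i j. i < j \<Longrightarrow> P (x (r i)) (x (r j))"
    using almost_full_on_homogeneous_subseq[of P A x, OF assms] by metis
  have "\<exists>i j. i < j \<and> set_emb P (X (r i) - {x (r i)}) (X (r j) - {x (r j)})"
  proof (rule minimal_bad_seq_good_below[OF min r])
    show "X n - {x n} \<in> Fpow A" for n
      using X[of n] by (auto simp: Fpow_def)
    show "card (X n - {x n}) < card (X n)" for n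
      using X(2) x by (rule card_Diff1_less)
    show "set_emb P Y (X n)" if "set_emb P Y (X n - {x n})" for Y n
      using that by (rule set_emb_mono) auto
  qed
  then obtain i j where "i < j" and tails: "set_emb P (X (r i) - {x (r i)}) (X (r j) - {x (r j)})"
    by blast
  have "set_emb P (X (r i)) (X (r j))"
    using tails heads[OF \<open>i < j\<close>] x by (rule set_emb_remove)
  with bad strict_monoD[OF r \<open>i < j\<close>] show False
    by blast
qed


section \<open>Hall's marriage theorem\<close>

definition hall_condition :: "'a set \<Rightarrow> ('a \<Rightarrow> 'b set) \<Rightarrow> bool" where
  "hall_condition I A \<longleftrightarrow> (\<forall>J\<subseteq>I. card J \<le> card (\<Union>j\<in>J. A j))"

lemma hall_conditionD:
  assumes "hall_condition I A" and "J \<subseteq> I"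
  shows "card J \<le> card (\<Union>j\<in>J. A j)"
  using assms by (simp add: hall_condition_def)

lemma hall_violator_upd:
  assumes "finite I" and "hall_condition I A" and "\<not> hall_condition I (A(i := B))"
  shows "\<exists>J\<subseteq>I - {i}. card ((\<Union>j\<in>J. A j) \<union> B) \<le> card J"
proof -
  obtain K where K: "K \<subseteq> I" "card (\<Union>j\<in>K. (A(i := B)) j) < card K"
    using assms(3) unfolding hall_condition_def not_all not_imp not_le by (elim exE conjE)
  have "i \<in> K"
  proof (rule ccontr)
    assume "i \<notin> K"
    then have "A(i := B) ` K = A ` K"
      by (intro image_cong) auto
    with K(2) hall_conditionD[OF assms(2) K(1)] show False
      by (simp only: not_less)
  qed
  then have "(\<Union>j\<in>K. (A(i := B)) j) = (\<Union>j\<in>K - {i}. A j) \<union> B"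
    by (auto split: if_splits)
  with K(2) have "card ((\<Union>j\<in>K - {i}. A j) \<union> B) < card K"
    by (simp only:)
  also have "card K = Suc (card (K - {i}))"
    using finite_subset[OF K(1) \<open>finite I\<close>] \<open>i \<in> K\<close> by (rule card_Suc_Diff1[symmetric])
  finally show ?thesis
    using K(1) by (intro exI[of _ "K - {i}"]) (simp add: Diff_mono less_Suc_eq_le)
qed

text \<open>Rado's argument: if neither \<open>x\<close> nor \<open>y\<close> could be removed from \<open>A i\<close>, the index sets
  violating the two conditions would contradict the modularity of cardinality.\<close>

lemma hall_condition_remove_one:
  assumes fin: "finite I" "\<And>j. j \<in> I \<Longrightarrow> finite (A j)"
    and hall: "hall_condition I A" and "i \<in> I" and "x \<noteq> y"
  shows "hall_condition I (A(i := A i - {x})) \<or> hall_condition I (A(i := A i - {y}))"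
proof (rule ccontr)
  let ?U = "\<lambda>J. \<Union>j\<in>J. A j"
  assume "\<not> ?thesis"
  then obtain J K where J: "J \<subseteq> I - {i}" "card (?U J \<union> (A i - {x})) \<le> card J"
    and K: "K \<subseteq> I - {i}" "card (?U K \<union> (A i - {y})) \<le> card K"
    using hall_violator_upd[OF fin(1) hall] by meson
  define X Y where "X = ?U J \<union> (A i - {x})" and "Y = ?U K \<union> (A i - {y})"
  have fin_JK: "finite J" "finite K" "i \<notin> J \<union> K"
    using J(1) K(1) fin(1) by (auto intro: finite_subset)
  then have fin_XY: "finite X" "finite Y"
    using J(1) K(1) fin(2) \<open>i \<in> I\<close> by (auto simp: X_def Y_def)
  have "Suc (card (J \<union> K)) = card (insert i (J \<union> K))"
    using fin_JK by simp
  also have "\<dots> \<le> card (?U (insert i (J \<union> K)))"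
    using J(1) K(1) \<open>i \<in> I\<close> by (intro hall_conditionD[OF hall]) auto
  also have "?U (insert i (J \<union> K)) = X \<union> Y"
    using \<open>x \<noteq> y\<close> by (auto simp: X_def Y_def)
  finally have union: "Suc (card (J \<union> K)) \<le> card (X \<union> Y)" .
  have "card (J \<inter> K) \<le> card (?U (J \<inter> K))"
    using J(1) by (intro hall_conditionD[OF hall]) auto
  also have "\<dots> \<le> card (X \<inter> Y)"
    using fin_XY by (intro card_mono) (auto simp: X_def Y_def)
  finally have "Suc (card J + card K) \<le> card X + card Y"
    using union card_Un_Int[OF fin_JK(1,2)] card_Un_Int[OF fin_XY] by linarith
  with J(2) K(2) show False
    by (simp add: X_def Y_def)
qed

lemma hall_marriage_subsingletons:
  assumes hall: "hall_condition I A"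
    and single: "\<And>i x y. i \<in> I \<Longrightarrow> x \<in> A i \<Longrightarrow> y \<in> A i \<Longrightarrow> x = y"
  shows "\<exists>f. inj_on f I \<and> (\<forall>i\<in>I. f i \<in> A i)"
proof -
  have "A i \<noteq> {}" if "i \<in> I" for i
    using hall_conditionD[OF hall, of "{i}"] that by auto
  then have "\<forall>i\<in>I. \<exists>x. x \<in> A i"
    by blast
  then obtain f where f: "\<And>i. i \<in> I \<Longrightarrow> f i \<in> A i"
    by metis
  then have A: "A i = {f i}" if "i \<in> I" for i
    using single that by blast
  have "inj_on f I"
  proof (rule inj_onI, rule ccontr)
    fix i j
    assume "i \<in> I" "j \<in> I" "f i = f j" "i \<noteq> j"
    then show False
      using hall_conditionD[OF hall, of "{i, j}"] A[of i] A[of j] by simp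
  qed
  with f show ?thesis
    by blast
qed

theorem hall_marriage:
  assumes "finite I" and "\<And>i. i \<in> I \<Longrightarrow> finite (A i)" and "hall_condition I A"
  shows "\<exists>f. inj_on f I \<and> (\<forall>i\<in>I. f i \<in> A i)"
  using assms(2,3)
proof (induction "\<Sum>i\<in>I. card (A i)" arbitrary: A rule: less_induct)
  case less
  show ?case
  proof (cases "\<exists>i\<in>I. \<exists>x\<in>A i. \<exists>y\<in>A i. x \<noteq> y")
    case True
    then obtain i x y where i: "i \<in> I" "x \<in> A i" "y \<in> A i" "x \<noteq> y"
      by blast
    then obtain z where z: "z \<in> A i" "hall_condition I (A(i := A i - {z}))"
      using hall_condition_remove_one[OF \<open>finite I\<close> less.prems i(1,4)] by blast
    have "card (A i - {z}) < card (A i)"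
      using less.prems(1) i(1) z(1) by (intro psubset_card_mono) auto
    then have "(\<Sum>j\<in>I. card ((A(i := A i - {z})) j)) < (\<Sum>j\<in>I. card (A j))"
      using \<open>finite I\<close> i(1) by (intro sum_strict_mono_ex1) auto
    moreover have "finite ((A(i := A i - {z})) j)" if "j \<in> I" for j
      using that less.prems(1)[of j] by auto
    ultimately have "\<exists>f. inj_on f I \<and> (\<forall>j\<in>I. f j \<in> (A(i := A i - {z})) j)"
      using z(2) by (rule less.hyps)
    then obtain f where "inj_on f I" and f: "\<And>j. j \<in> I \<Longrightarrow> f j \<in> (A(i := A i - {z})) j"
      by blast
    moreover have "f j \<in> A j" if "j \<in> I" for j
      using f[OF that] by (cases "j = i") auto
    ultimately show ?thesis
      by blast
  next
    case False
    then show ?thesis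
      using less.prems(2) by (intro hall_marriage_subsingletons) auto
  qed
qed

lemma set_emb_iff_hall:
  assumes "finite A" and "finite B"
  shows "set_emb P A B \<longleftrightarrow> (\<forall>S\<in>Pow A. card S \<le> card {b \<in> B. \<exists>a\<in>S. P a b})"
proof (intro iffI ballI)
  fix S
  assume "set_emb P A B" "S \<in> Pow A"
  then have "card {a \<in> A. a \<in> S} \<le> card {b \<in> B. \<exists>a\<in>S. P a b}"
    using \<open>finite B\<close> by (intro set_emb_card_filter_mono[of P A B]) auto
  moreover have "{a \<in> A. a \<in> S} = S"
    using \<open>S \<in> Pow A\<close> by blast
  ultimately show "card S \<le> card {b \<in> B. \<exists>a\<in>S. P a b}"
    by simp
next
  assume counts: "\<forall>S\<in>Pow A. card S \<le> card {b \<in> B. \<exists>a\<in>S. P a b}"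
  have "(\<Union>a\<in>S. {b \<in> B. P a b}) = {b \<in> B. \<exists>a\<in>S. P a b}" for S
    by blast
  with counts have "hall_condition A (\<lambda>a. {b \<in> B. P a b})"
    by (simp add: hall_condition_def)
  then show "set_emb P A B"
    using hall_marriage[OF \<open>finite A\<close>, of "\<lambda>a. {b \<in> B. P a b}"] \<open>finite B\<close>
    by (simp add: set_emb_def)
qed


section \<open>Pointed graphs and graded simulations\<close>

type_synonym 'v pointed = "'v lgraph \<times> 'v"

definition pointed_lgraphs :: "nat \<Rightarrow> 'v pointed set" where
  "pointed_lgraphs d = {p. pointed_lgraph d (fst p) (snd p)}"

definition nbrs :: "'v pointed \<Rightarrow> 'v pointed set" where
  "nbrs p = Pair (fst p) ` {w. {snd p, w} \<in> edges (fst p)}"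

definition lab_at :: "'v pointed \<Rightarrow> real vec" where
  "lab_at p = lab (fst p) (snd p)"

definition holds_at :: "gml \<Rightarrow> 'v pointed \<Rightarrow> bool" where
  "holds_at \<phi> p \<longleftrightarrow> sat (kripke_of (fst p)) (snd p) \<phi>"

definition bool_vecs :: "nat \<Rightarrow> real vec set" where
  "bool_vecs d = {x \<in> carrier_vec d. \<forall>i<d. x $ i \<in> {0, 1}}"

primrec sim :: "nat \<Rightarrow> 'u pointed \<Rightarrow> 'v pointed \<Rightarrow> bool" where
  "sim 0 p q \<longleftrightarrow> lab_at p \<le> lab_at q"
| "sim (Suc l) p q \<longleftrightarrow> lab_at p \<le> lab_at q \<and> set_emb (sim l) (nbrs p) (nbrs q)"

lemma lab_at_bool_vecs: "p \<in> pointed_lgraphs d \<Longrightarrow> lab_at p \<in> bool_vecs d"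
  by (simp add: pointed_lgraphs_def pointed_lgraph_def is_lgraph_def lab_at_def bool_vecs_def)

lemma nbrs_pointed_lgraphs:
  assumes "p \<in> pointed_lgraphs d"
  shows "nbrs p \<subseteq> pointed_lgraphs d"
  using assms by (fastforce simp: pointed_lgraphs_def pointed_lgraph_def is_lgraph_def nbrs_def)

lemma finite_nbrs:
  assumes "p \<in> pointed_lgraphs d"
  shows "finite (nbrs p)"
proof (rule finite_subset)
  show "nbrs p \<subseteq> Pair (fst p) ` nodes (fst p)"
    using nbrs_pointed_lgraphs[OF assms]
    by (force simp: pointed_lgraphs_def pointed_lgraph_def nbrs_def)
  show "finite (Pair (fst p) ` nodes (fst p))"
    using assms by (simp add: pointed_lgraphs_def pointed_lgraph_def is_lgraph_def)
qed

lemma holds_at_simps [simp]: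
  "holds_at (Prop i) p \<longleftrightarrow> lab_at p $ (i - 1) = 1"
  "holds_at Top p" "\<not> holds_at Bot p"
  "holds_at (Conj \<phi> \<psi>) p \<longleftrightarrow> holds_at \<phi> p \<and> holds_at \<psi> p"
  "holds_at (Disj \<phi> \<psi>) p \<longleftrightarrow> holds_at \<phi> p \<or> holds_at \<psi> p"
  by (simp_all add: holds_at_def kripke_of_def lab_at_def)

lemma holds_at_Dia:
  assumes "p \<in> pointed_lgraphs d"
  shows "holds_at (Dia k \<phi>) p \<longleftrightarrow> k \<le> card {q \<in> nbrs p. holds_at \<phi> q}"
proof -
  let ?W = "{w. {snd p, w} \<in> edges (fst p) \<and> sat (kripke_of (fst p)) w \<phi>}"
  have nbrs: "{q \<in> nbrs p. holds_at \<phi> q} = Pair (fst p) ` ?W"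
    by (auto simp: nbrs_def holds_at_def)
  then have card: "card {q \<in> nbrs p. holds_at \<phi> q} = card ?W"
    by (simp add: card_image inj_on_def)
  have "finite (Pair (fst p) ` ?W)"
    using finite_nbrs[OF assms] unfolding nbrs[symmetric] by simp
  then have fin: "finite ?W"
    by (rule finite_imageD) (simp add: inj_on_def)
  have "holds_at (Dia k \<phi>) p \<longleftrightarrow> (\<exists>U\<subseteq>?W. finite U \<and> card U = k)"
    by (auto simp: holds_at_def kripke_of_def)
  also have "\<dots> \<longleftrightarrow> k \<le> card ?W"
    using card_mono[OF fin] obtain_subset_with_card_n[of k ?W] by blast
  finally show ?thesis
    by (simp add: card)
qed

lemma sim_SucD: "sim (Suc l) p q \<Longrightarrow> sim l p q"
proof (induction l arbitrary: p q)
  case (Suc l)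
  then have "set_emb (sim (Suc l)) (nbrs p) (nbrs q)"
    unfolding sim.simps(2)[of "Suc l"] by blast
  then have "set_emb (sim l) (nbrs p) (nbrs q)"
    by (rule set_emb_mono) (simp_all add: Suc.IH del: sim.simps)
  with Suc.prems show ?case
    by simp
qed simp

lemma finite_bool_vecs: "finite (bool_vecs d)"
proof (rule finite_subset)
  show "bool_vecs d \<subseteq> (\<lambda>S. vec d (\<lambda>i. of_bool (i \<in> S))) ` Pow {..<d}"
  proof
    fix x
    assume "x \<in> bool_vecs d"
    then have "x = vec d (\<lambda>i. of_bool (i \<in> {i. i < d \<and> x $ i = 1}))"
      by (intro eq_vecI) (auto simp: bool_vecs_def)
    then show "x \<in> (\<lambda>S. vec d (\<lambda>i. of_bool (i \<in> S))) ` Pow {..<d}"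
      by blast
  qed
qed simp

lemma almost_full_on_sim: "almost_full_on (sim l) (pointed_lgraphs d :: 'v pointed set)"
proof (induction l)
  have "almost_full_on (\<le>) (bool_vecs d)"
    using finite_bool_vecs by (rule almost_full_on_finite) (simp add: reflp_on_def)
  moreover have "lab_at \<in> (pointed_lgraphs d :: 'v pointed set) \<rightarrow> bool_vecs d"
    using lab_at_bool_vecs by blast
  ultimately have labels:
      "almost_full_on (\<lambda>p q. lab_at p \<le> lab_at q) (pointed_lgraphs d :: 'v pointed set)"
    by (rule almost_full_on_vimage)
  case 0
  from labels show ?case
    by simp
  case (Suc l)
  have "nbrs \<in> (pointed_lgraphs d :: 'v pointed set) \<rightarrow> Fpow (pointed_lgraphs d)"
    unfolding Fpow_def using nbrs_pointed_lgraphs finite_nbrs by blast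
  with almost_full_on_set_emb[OF Suc.IH]
  have "almost_full_on (\<lambda>p q. set_emb (sim l) (nbrs p) (nbrs q)) (pointed_lgraphs d :: 'v pointed set)"
    by (rule almost_full_on_vimage)
  with labels show ?case
    unfolding sim.simps by (rule almost_full_on_conj)
qed


section \<open>The order on multisets\<close>

lemma mset_le_iff_set_emb:
  "mset_le M M' \<longleftrightarrow> set_emb (\<lambda>s t. fst s \<le> fst t) (occs M) (occs M')"
  by (auto simp: mset_le_def set_emb_def)

lemma occs_eq_Sigma: "occs M = (SIGMA x:set_mset M. {..<count M x})"
  by (auto simp: occs_def intro: count_inI)

lemma size_filter_mset_eq_card_occs: "size (filter_mset Q M) = card {s \<in> occs M. Q (fst s)}"
proof -
  have "{s \<in> occs M. Q (fst s)} = (SIGMA x:set_mset (filter_mset Q M). {..<count M x})"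
    by (auto simp: occs_eq_Sigma)
  then show ?thesis
    by (simp add: size_multiset_overloaded_eq)
qed

lemma size_filter_mset_mono:
  assumes "mset_le M M'" and "mono_on (set_mset M \<union> set_mset M') Q"
  shows "size (filter_mset Q M) \<le> size (filter_mset Q M')"
  unfolding size_filter_mset_eq_card_occs
proof (rule set_emb_card_filter_mono)
  show "set_emb (\<lambda>s t. fst s \<le> fst t) (occs M) (occs M')"
    using assms(1) by (simp add: mset_le_iff_set_emb)
  show "finite (occs M')"
    by (simp add: occs_eq_Sigma)
  show "Q (fst t)" if "s \<in> occs M" "t \<in> occs M'" "fst s \<le> fst t" "Q (fst s)" for s t
    using mono_onD[OF assms(2), of "fst s" "fst t"] that by (auto simp: occs_eq_Sigma)
qed

lemma ex_bij_betw_occs_image_mset: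
  assumes "finite X"
  shows "\<exists>e. bij_betw e X (occs (image_mset g (mset_set X))) \<and> (\<forall>x\<in>X. fst (e x) = g x)"
proof -
  define fibre where "fibre y = {x \<in> X. g x = y}" for y
  have count: "count (image_mset g (mset_set X)) y = card (fibre y)" for y
  proof -
    have "g -` {y} \<inter> X = fibre y"
      by (auto simp: fibre_def)
    moreover have "(\<Sum>x\<in>fibre y. count (mset_set X) x) = (\<Sum>x\<in>fibre y. 1)"
      using assms by (intro sum.cong) (auto simp: fibre_def)
    ultimately show ?thesis
      using assms by (simp add: count_image_mset)
  qed
  have "\<forall>y. \<exists>h. bij_betw h (fibre y) {0..<card (fibre y)}"
    using assms by (intro allI ex_bij_betw_finite_nat) (simp add: fibre_def)
  then obtain h where h: "\<And>y. bij_betw (h y) (fibre y) {0..<card (fibre y)}"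
    by metis
  define e where "e x = (g x, h (g x) x)" for x
  have "inj_on e X"
    using bij_betw_imp_inj_on[OF h] by (auto simp: e_def inj_on_def fibre_def)
  moreover have "e ` X = occs (image_mset g (mset_set X))"
  proof -
    have "e ` X = (SIGMA y:UNIV. h y ` fibre y)"
      by (auto simp: e_def fibre_def)
    also have "\<dots> = occs (image_mset g (mset_set X))"
      using bij_betw_imp_surj_on[OF h] by (auto simp: occs_def count)
    finally show ?thesis .
  qed
  ultimately show ?thesis
    unfolding bij_betw_def by (intro exI[of _ e]) (simp add: e_def)
qed

lemma mset_le_image_mset_set:
  assumes "finite X" and "finite Y" and "set_emb (\<lambda>x y. g x \<le> h y) X Y"
  shows "mset_le (image_mset g (mset_set X)) (image_mset h (mset_set Y))"
proof -
  let ?M = "image_mset g (mset_set X)" and ?M' = "image_mset h (mset_set Y)"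
  obtain a where a: "bij_betw a X (occs ?M)" "\<forall>x\<in>X. fst (a x) = g x"
    using ex_bij_betw_occs_image_mset[OF \<open>finite X\<close>] by blast
  obtain b where b: "bij_betw b Y (occs ?M')" "\<forall>y\<in>Y. fst (b y) = h y"
    using ex_bij_betw_occs_image_mset[OF \<open>finite Y\<close>] by blast
  have "set_emb (\<lambda>s x. fst s = g x) (occs ?M) X"
    unfolding set_emb_def
  proof (intro exI conjI ballI)
    show "inj_on (inv_into X a) (occs ?M)"
      using bij_betw_inv_into[OF a(1)] by (rule bij_betw_imp_inj_on)
    show inv: "inv_into X a s \<in> X" if "s \<in> occs ?M" for s
      using bij_betw_inv_into[OF a(1)] that by (rule bij_betwE[rule_format])
    show "fst s = g (inv_into X a s)" if "s \<in> occs ?M" for s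
      using a(2) inv[OF that] bij_betw_inv_into_right[OF a(1) that] by metis
  qed
  moreover have "set_emb (\<lambda>y t. h y = fst t) Y (occs ?M')"
    unfolding set_emb_def
    using b bij_betw_imp_inj_on[OF b(1)] bij_betwE[OF b(1)] by (intro exI[of _ b]) simp
  ultimately have "set_emb ((\<lambda>s x. fst s = g x) OO (\<lambda>x y. g x \<le> h y) OO (\<lambda>y t. h y = fst t))
      (occs ?M) (occs ?M')"
    using assms(3) by (intro set_emb_trans)
  then show ?thesis
    unfolding mset_le_iff_set_emb by (rule set_emb_mono) auto
qed


section \<open>GNNs on pointed graphs\<close>

definition gnn_layer :: "gnn \<Rightarrow> nat \<Rightarrow> real vec \<Rightarrow> real vec multiset \<Rightarrow> real vec" where
  "gnn_layer N l x M = gnn_comb N l (x @\<^sub>v gnn_agg N l M)"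

definition gnn_lab_at :: "gnn \<Rightarrow> nat \<Rightarrow> 'v pointed \<Rightarrow> real vec" where
  "gnn_lab_at N l p = gnn_lab N (fst p) l (snd p)"

definition nbr_labs :: "gnn \<Rightarrow> nat \<Rightarrow> 'v pointed \<Rightarrow> real vec multiset" where
  "nbr_labs N l p = image_mset (gnn_lab_at N l) (mset_set (nbrs p))"

definition gnn_run_at :: "gnn \<Rightarrow> 'v pointed \<Rightarrow> bool" where
  "gnn_run_at N p \<longleftrightarrow> gnn_run N (fst p) (snd p)"

lemma gnn_lab_at_0 [simp]: "gnn_lab_at N 0 p = lab_at p"
  by (simp add: gnn_lab_at_def lab_at_def)

lemma gnn_lab_at_Suc [simp]:
  "gnn_lab_at N (Suc l) p = gnn_layer N (Suc l) (gnn_lab_at N l p) (nbr_labs N l p)"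
proof -
  let ?W = "{w. {snd p, w} \<in> edges (fst p)}"
  have "mset_set (nbrs p) = image_mset (Pair (fst p)) (mset_set ?W)"
    unfolding nbrs_def by (rule image_mset_mset_set[symmetric]) (simp add: inj_on_def)
  then have "nbr_labs N l p = image_mset (gnn_lab N (fst p) l) (mset_set ?W)"
    by (simp add: nbr_labs_def gnn_lab_at_def multiset.map_comp comp_def)
  then show ?thesis
    by (simp add: gnn_layer_def gnn_lab_at_def)
qed

lemma gnn_run_at_iff: "gnn_run_at N p \<longleftrightarrow> gnn_cls N (gnn_lab_at N (gnn_depth N) p)"
  by (simp add: gnn_run_at_def gnn_run_def gnn_lab_at_def)

context
  fixes d :: nat and N :: gnn and l :: nat
  assumes gnn: "is_gnn d N" and l: "Suc l \<le> gnn_depth N"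
begin

lemma gnn_agg_carrier:
  assumes "M \<in> vec_msets (gnn_dim N l)"
  shows "gnn_agg N (Suc l) M \<in> carrier_vec (gnn_agg_dim N (Suc l))"
proof -
  have "gnn_agg N (Suc l) \<in> vec_msets (gnn_dim N l) \<rightarrow> carrier_vec (gnn_agg_dim N (Suc l))"
    using gnn l unfolding is_gnn_def by force
  with assms show ?thesis
    by blast
qed

lemma gnn_layer_carrier:
  assumes "x \<in> carrier_vec (gnn_dim N l)" and "M \<in> vec_msets (gnn_dim N l)"
  shows "gnn_layer N (Suc l) x M \<in> carrier_vec (gnn_dim N (Suc l))"
proof -
  have "gnn_comb N (Suc l) \<in> carrier_vec (gnn_dim N l + gnn_agg_dim N (Suc l))
      \<rightarrow> carrier_vec (gnn_dim N (Suc l))"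
    using gnn l unfolding is_gnn_def by force
  then show ?thesis
    unfolding gnn_layer_def using append_carrier_vec[OF assms(1) gnn_agg_carrier[OF assms(2)]]
    by blast
qed

lemma gnn_layer_mono:
  assumes mono: "monotonic_gnn N"
    and x: "x \<in> carrier_vec (gnn_dim N l)" "y \<in> carrier_vec (gnn_dim N l)" "x \<le> y"
    and M: "M \<in> vec_msets (gnn_dim N l)" "M' \<in> vec_msets (gnn_dim N l)" "mset_le M M'"
  shows "gnn_layer N (Suc l) x M \<le> gnn_layer N (Suc l) y M'"
proof -
  have "Suc l \<in> {1..gnn_depth N}"
    using l by simp
  then have agg_mono: "monotone_on (vec_msets (gnn_dim N l)) mset_le (\<le>) (gnn_agg N (Suc l))"
    and comb_mono: "mono_on (carrier_vec (gnn_dim N l + gnn_agg_dim N (Suc l))) (gnn_comb N (Suc l))"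
    using mono unfolding monotonic_gnn_def by force+
  have "gnn_agg N (Suc l) M \<le> gnn_agg N (Suc l) M'"
    using agg_mono M by (rule monotone_onD)
  then have "x @\<^sub>v gnn_agg N (Suc l) M \<le> y @\<^sub>v gnn_agg N (Suc l) M'"
    using append_vec_le[OF x(1,2)] x(3) by simp
  with x M show ?thesis
    unfolding gnn_layer_def
    by (intro mono_onD[OF comb_mono] append_carrier_vec gnn_agg_carrier)
qed

end

lemma nbr_labs_vec_msets:
  fixes p :: "'v pointed"
  assumes "p \<in> pointed_lgraphs d"
    and "\<And>q :: 'v pointed. q \<in> pointed_lgraphs d \<Longrightarrow> gnn_lab_at N l q \<in> carrier_vec n"
  shows "nbr_labs N l p \<in> vec_msets n"
proof -
  have "gnn_lab_at N l q \<in> carrier_vec n" if "q \<in> nbrs p" for q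
    using assms(2) nbrs_pointed_lgraphs[OF assms(1)] that by blast
  then show ?thesis
    using finite_nbrs[OF assms(1)] by (simp add: vec_msets_def nbr_labs_def image_subset_iff)
qed

lemma gnn_lab_at_carrier:
  assumes "is_gnn d N" and "l \<le> gnn_depth N" and "p \<in> pointed_lgraphs d"
  shows "gnn_lab_at N l p \<in> carrier_vec (gnn_dim N l)"
  using assms(2,3)
proof (induction l arbitrary: p)
  case 0
  then show ?case
    using lab_at_bool_vecs[of p d] assms(1) by (simp add: is_gnn_def bool_vecs_def)
next
  case (Suc l)
  have "nbr_labs N l p \<in> vec_msets (gnn_dim N l)"
    using Suc.prems(1) by (intro nbr_labs_vec_msets[OF Suc.prems(2)] Suc.IH) simp_all
  then show ?case
    using Suc assms(1) by (simp add: gnn_layer_carrier)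
qed

lemma gnn_lab_at_mono:
  assumes N: "is_gnn d N" "monotonic_gnn N"
    and "p \<in> pointed_lgraphs d" and "q \<in> pointed_lgraphs d"
    and "l \<le> gnn_depth N" and "sim l p q"
  shows "gnn_lab_at N l p \<le> gnn_lab_at N l q"
  using assms(3-)
proof (induction l arbitrary: p q)
  case 0
  then show ?case
    by simp
next
  case (Suc l)
  then have l: "l \<le> gnn_depth N"
    by simp
  have "set_emb (sim l) (nbrs p) (nbrs q)"
    using Suc.prems(4) by simp
  then have "set_emb (\<lambda>p' q'. gnn_lab_at N l p' \<le> gnn_lab_at N l q') (nbrs p) (nbrs q)"
    using nbrs_pointed_lgraphs[OF Suc.prems(1)] nbrs_pointed_lgraphs[OF Suc.prems(2)] l
    by (elim set_emb_mono) (auto intro: Suc.IH)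
  then have "mset_le (nbr_labs N l p) (nbr_labs N l q)"
    unfolding nbr_labs_def
    by (intro mset_le_image_mset_set finite_nbrs[OF Suc.prems(1)] finite_nbrs[OF Suc.prems(2)])
  moreover have "gnn_lab_at N l p \<le> gnn_lab_at N l q"
    using Suc.prems(1,2) l sim_SucD[OF Suc.prems(4)] by (rule Suc.IH)
  ultimately show ?case
    unfolding gnn_lab_at_Suc using N Suc.prems(1-3) l
    by (intro gnn_layer_mono gnn_lab_at_carrier nbr_labs_vec_msets)
qed

lemma gnn_run_at_mono:
  assumes N: "is_gnn d N" "monotonic_gnn N"
    and pq: "p \<in> pointed_lgraphs d" "q \<in> pointed_lgraphs d" "sim (gnn_depth N) p q"
    and "gnn_run_at N p"
  shows "gnn_run_at N q"
proof -
  let ?L = "gnn_depth N"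
  have "mono_on (carrier_vec (gnn_dim N ?L)) (gnn_cls N)"
    using N(2) by (simp add: monotonic_gnn_def)
  moreover note gnn_lab_at_carrier[OF N(1) order_refl pq(1)] gnn_lab_at_carrier[OF N(1) order_refl pq(2)]
    and gnn_lab_at_mono[OF N pq(1,2) order_refl pq(3)]
  ultimately have "gnn_cls N (gnn_lab_at N ?L p) \<le> gnn_cls N (gnn_lab_at N ?L q)"
    by (rule mono_onD)
  with \<open>gnn_run_at N p\<close> show ?thesis
    by (simp add: gnn_run_at_iff)
qed


section \<open>Definability\<close>

definition definable :: "nat \<Rightarrow> ('v pointed \<Rightarrow> bool) \<Rightarrow> bool" where
  "definable d Q \<longleftrightarrow> (\<exists>\<phi>\<in>ex_pos_gml d. \<forall>p\<in>pointed_lgraphs d. Q p \<longleftrightarrow> holds_at \<phi> p)"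

lemma definableI:
  assumes "\<phi> \<in> ex_pos_gml d" and "\<And>p. p \<in> pointed_lgraphs d \<Longrightarrow> Q p \<longleftrightarrow> holds_at \<phi> p"
  shows "definable d Q"
  using assms unfolding definable_def by blast

lemma definable_cong:
  assumes "definable d Q" and "\<And>p. p \<in> pointed_lgraphs d \<Longrightarrow> Q' p \<longleftrightarrow> Q p"
  shows "definable d Q'"
  using assms unfolding definable_def by simp

lemma definable_const: "definable d (\<lambda>p. b)"
  by (rule definableI[of "if b then Top else Bot"]) (simp_all add: ex_pos_gml_def)

lemma definable_combine:
  fixes Q R :: "'v pointed \<Rightarrow> bool"
  assumes "definable d Q" and "definable d R"
    and "\<And>\<phi> \<psi>. \<phi> \<in> ex_pos_gml d \<Longrightarrow> \<psi> \<in> ex_pos_gml d \<Longrightarrow> C \<phi> \<psi> \<in> ex_pos_gml d"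
    and "\<And>\<phi> \<psi> (p :: 'v pointed). holds_at (C \<phi> \<psi>) p \<longleftrightarrow> f (holds_at \<phi> p) (holds_at \<psi> p)"
  shows "definable d (\<lambda>p. f (Q p) (R p))"
proof -
  obtain \<phi> \<psi> where "\<phi> \<in> ex_pos_gml d" "\<psi> \<in> ex_pos_gml d"
    and "\<forall>p\<in>pointed_lgraphs d. Q p \<longleftrightarrow> holds_at \<phi> p" "\<forall>p\<in>pointed_lgraphs d. R p \<longleftrightarrow> holds_at \<psi> p"
    using assms(1,2) unfolding definable_def by (elim bexE)
  then show ?thesis
    by (intro definableI[of "C \<phi> \<psi>"]) (simp_all add: assms(3,4))
qed

lemma definable_conj:
  assumes "definable d Q" and "definable d R"
  shows "definable d (\<lambda>p. Q p \<and> R p)"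
  by (rule definable_combine[of d Q R Conj, OF assms]) (simp_all add: ex_pos_gml_def)

lemma definable_disj:
  assumes "definable d Q" and "definable d R"
  shows "definable d (\<lambda>p. Q p \<or> R p)"
  by (rule definable_combine[of d Q R Disj, OF assms]) (simp_all add: ex_pos_gml_def)

lemma definable_ball:
  assumes "finite S" and "\<And>s. s \<in> S \<Longrightarrow> definable d (Q s)"
  shows "definable d (\<lambda>p. \<forall>s\<in>S. Q s p)"
  using assms by (induction S) (simp_all add: definable_const definable_conj)

lemma definable_bex:
  assumes "finite S" and "\<And>s. s \<in> S \<Longrightarrow> definable d (Q s)"
  shows "definable d (\<lambda>p. \<exists>s\<in>S. Q s p)"
  using assms by (induction S) (simp_all add: definable_const definable_disj)

lemma definable_card_nbrs_ge:
  assumes "definable d Q"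
  shows "definable d (\<lambda>p. k \<le> card {q \<in> nbrs p. Q q})"
proof (cases "k = 0")
  case True
  then show ?thesis
    by (simp add: definable_const)
next
  case False
  obtain \<phi> where \<phi>: "\<phi> \<in> ex_pos_gml d" "\<forall>p\<in>pointed_lgraphs d. Q p \<longleftrightarrow> holds_at \<phi> p"
    using assms unfolding definable_def by (elim bexE)
  show ?thesis
  proof (rule definableI)
    show "Dia k \<phi> \<in> ex_pos_gml d"
      using \<phi>(1) False by (simp add: ex_pos_gml_def)
    show "k \<le> card {q \<in> nbrs p. Q q} \<longleftrightarrow> holds_at (Dia k \<phi>) p" if "p \<in> pointed_lgraphs d" for p
    proof -
      have "{q \<in> nbrs p. Q q} = {q \<in> nbrs p. holds_at \<phi> q}"
        using nbrs_pointed_lgraphs[OF that] \<phi>(2) by blast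
      then show ?thesis
        by (simp only: holds_at_Dia[OF that])
    qed
  qed
qed

lemma definable_lab_at_ge:
  assumes "x \<in> bool_vecs d"
  shows "definable d (\<lambda>p. x \<le> lab_at p)"
proof (rule definable_cong)
  show "definable d (\<lambda>p. \<forall>i\<in>{i. i < d \<and> x $ i = 1}. lab_at p $ i = 1)"
    by (intro definable_ball definableI[of "Prop (Suc i)" for i]) (simp_all add: ex_pos_gml_def)
  show "x \<le> lab_at p \<longleftrightarrow> (\<forall>i\<in>{i. i < d \<and> x $ i = 1}. lab_at p $ i = 1)"
    if "p \<in> pointed_lgraphs d" for p
    using assms lab_at_bool_vecs[OF that] by (force simp: bool_vecs_def less_eq_vec_def)
qed

text \<open>Graded modalities cannot express an injection into the neighbours directly, but
  Hall's theorem replaces it by one counting condition per set of neighbours of \<open>p\<close>.\<close>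

lemma definable_sim:
  fixes p :: "'u pointed"
  assumes "p \<in> pointed_lgraphs d"
  shows "definable d (sim l p :: 'v pointed \<Rightarrow> bool)"
  using assms
proof (induction l arbitrary: p)
  case 0
  then show ?case
    by (simp add: definable_lab_at_ge lab_at_bool_vecs)
next
  case (Suc l)
  note fin = finite_nbrs[OF Suc.prems]
  show ?case
  proof (rule definable_cong)
    have "definable d (\<lambda>q :: 'v pointed. card S \<le> card {q' \<in> nbrs q. \<exists>p'\<in>S. sim l p' q'})"
      if "S \<in> Pow (nbrs p)" for S
    proof (intro definable_card_nbrs_ge definable_bex Suc.IH)
      show "finite S"
        using that fin by (auto intro: finite_subset)
      show "p' \<in> pointed_lgraphs d" if "p' \<in> S" for p'
        using that \<open>S \<in> Pow (nbrs p)\<close> nbrs_pointed_lgraphs[OF Suc.prems] by blast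
    qed
    then show "definable d (\<lambda>q :: 'v pointed. lab_at p \<le> lab_at q \<and>
        (\<forall>S\<in>Pow (nbrs p). card S \<le> card {q' \<in> nbrs q. \<exists>p'\<in>S. sim l p' q'}))"
      using lab_at_bool_vecs[OF Suc.prems] fin
      by (intro definable_conj definable_lab_at_ge definable_ball) simp_all
    show "sim (Suc l) p q \<longleftrightarrow> lab_at p \<le> lab_at q \<and>
        (\<forall>S\<in>Pow (nbrs p). card S \<le> card {q' \<in> nbrs q. \<exists>p'\<in>S. sim l p' q'})"
      if "q \<in> pointed_lgraphs d" for q
      unfolding sim.simps set_emb_iff_hall[OF fin finite_nbrs[OF that]] ..
  qed
qed

theorem definable_if_sim_closed:
  fixes Q :: "'v pointed \<Rightarrow> bool"
  assumes closed: "\<And>p q. p \<in> pointed_lgraphs d \<Longrightarrow> q \<in> pointed_lgraphs d \<Longrightarrow>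
    sim l p q \<Longrightarrow> Q p \<Longrightarrow> Q q"
  shows "definable d Q"
proof -
  let ?U = "{p \<in> pointed_lgraphs d. Q p}"
  have "almost_full_on (sim l) ?U"
    using almost_full_on_sim by (rule almost_full_on_subset[of _ "pointed_lgraphs d"]) blast
  from almost_full_on_finite_basis[OF this] obtain B
    where B: "finite B" "B \<subseteq> ?U" "\<forall>q\<in>?U. \<exists>p\<in>B. sim l p q"
    by (elim exE conjE)
  show ?thesis
  proof (rule definable_cong)
    show "definable d (\<lambda>q. \<exists>p\<in>B. sim l p q)"
      using B(1,2) by (intro definable_bex definable_sim) auto
    show "Q q \<longleftrightarrow> (\<exists>p\<in>B. sim l p q)" if "q \<in> pointed_lgraphs d" for q
      using B(2,3) closed that by blast
  qed
qed


section \<open>Recognition by monotonic GNNs\<close>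

definition gnn_recognizable :: "nat \<Rightarrow> ('v pointed \<Rightarrow> bool) \<Rightarrow> bool" where
  "gnn_recognizable d Q \<longleftrightarrow>
     (\<exists>N. is_gnn d N \<and> monotonic_gnn N \<and> (\<forall>p\<in>pointed_lgraphs d. gnn_run_at N p \<longleftrightarrow> Q p))"

theorem gnn_recognizable_imp_definable:
  assumes "gnn_recognizable d Q"
  shows "definable d Q"
proof -
  obtain N where N: "is_gnn d N" "monotonic_gnn N"
    and run: "\<forall>p\<in>pointed_lgraphs d. gnn_run_at N p \<longleftrightarrow> Q p"
    using assms unfolding gnn_recognizable_def by blast
  show ?thesis
  proof (rule definable_if_sim_closed)
    show "Q q" if "p \<in> pointed_lgraphs d" "q \<in> pointed_lgraphs d" "sim (gnn_depth N) p q" "Q p" for p q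
      using gnn_run_at_mono[OF N that(1-3)] run that by blast
  qed
qed

definition truth_vec :: "('v pointed \<Rightarrow> bool) list \<Rightarrow> 'v pointed \<Rightarrow> real vec" where
  "truth_vec Qs p = vec (length Qs) (\<lambda>i. of_bool ((Qs ! i) p))"

lemma dim_truth_vec [simp]: "dim_vec (truth_vec Qs p) = length Qs"
  by (simp add: truth_vec_def)

definition computes :: "nat \<Rightarrow> gnn \<Rightarrow> ('v pointed \<Rightarrow> bool) list \<Rightarrow> bool" where
  "computes d N Qs \<longleftrightarrow> is_gnn d N \<and> monotonic_gnn N \<and> gnn_dim N (gnn_depth N) = length Qs \<and>
     (\<forall>p\<in>pointed_lgraphs d. gnn_lab_at N (gnn_depth N) p = truth_vec Qs p)"

definition input_gnn :: "nat \<Rightarrow> gnn" where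
  "input_gnn d =
     \<lparr>gnn_depth = 0, gnn_dim = (\<lambda>l. d), gnn_agg_dim = (\<lambda>l. 0), gnn_agg = (\<lambda>l M. 0\<^sub>v 0),
      gnn_comb = (\<lambda>l x. x), gnn_cls = (\<lambda>x. True)\<rparr>"

text \<open>\<open>R\<close> is evaluated at the current label of a node followed by the number of its neighbours
  whose label satisfies \<open>Q\<close>. The classifier is a placeholder until all layers are present.\<close>

definition append_layer :: "(real vec \<Rightarrow> bool) \<Rightarrow> (real vec \<Rightarrow> bool) \<Rightarrow> gnn \<Rightarrow> gnn" where
  "append_layer Q R N = (let L = gnn_depth N; n = gnn_dim N L in
     \<lparr>gnn_depth = Suc L,
      gnn_dim = (gnn_dim N)(Suc L := Suc n),
      gnn_agg_dim = (gnn_agg_dim N)(Suc L := 1),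
      gnn_agg = (gnn_agg N)(Suc L := \<lambda>M. vec 1 (\<lambda>_. real (size (filter_mset Q M)))),
      gnn_comb = (gnn_comb N)(Suc L :=
        \<lambda>z. vec (Suc n) (\<lambda>i. if i < n then z $ i else of_bool (R z))),
      gnn_cls = (\<lambda>x. True)\<rparr>)"

lemma computes_input_gnn:
  "computes d (input_gnn d) (map (\<lambda>i. holds_at (Prop i) :: 'v pointed \<Rightarrow> bool) [1..<Suc d])"
proof -
  have "lab_at p = truth_vec (map (\<lambda>i. holds_at (Prop i)) [1..<Suc d]) p"
    if "p \<in> pointed_lgraphs d" for p :: "'v pointed"
    using lab_at_bool_vecs[OF that]
    by (intro eq_vecI) (auto simp: truth_vec_def bool_vecs_def simp del: upt_Suc)
  then show ?thesis
    by (simp add: computes_def input_gnn_def is_gnn_def monotonic_gnn_def mono_on_def del: upt_Suc)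
qed

lemma is_gnn_append_layer:
  assumes "is_gnn d N"
  shows "is_gnn d (append_layer Q R N)"
  using assms by (auto simp: is_gnn_def append_layer_def Let_def)

lemma monotonic_append_layer:
  assumes "monotonic_gnn N" and Q: "mono_on (carrier_vec (gnn_dim N (gnn_depth N))) Q"
    and R: "mono_on (carrier_vec (Suc (gnn_dim N (gnn_depth N)))) R"
  shows "monotonic_gnn (append_layer Q R N)"
proof -
  let ?L = "gnn_depth N"
  define n where "n = gnn_dim N ?L"
  have "monotone_on (vec_msets n) mset_le (\<le>) (\<lambda>M. vec 1 (\<lambda>_. real (size (filter_mset Q M))))"
  proof (rule monotone_onI)
    fix M M'
    assume "M \<in> vec_msets n" "M' \<in> vec_msets n" "mset_le M M'"
    moreover from this have "mono_on (set_mset M \<union> set_mset M') Q"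
      by (intro mono_on_subset[OF Q]) (simp add: vec_msets_def n_def)
    ultimately show "vec 1 (\<lambda>_. real (size (filter_mset Q M)))
        \<le> vec 1 (\<lambda>_. real (size (filter_mset Q M')))"
      by (simp add: less_eq_vec_def size_filter_mset_mono)
  qed
  moreover have "mono_on (carrier_vec (Suc n))
      (\<lambda>z. vec (Suc n) (\<lambda>i. if i < n then z $ i else of_bool (R z)))"
  proof (rule mono_onI)
    fix x y :: "real vec"
    assume xy: "x \<in> carrier_vec (Suc n)" "y \<in> carrier_vec (Suc n)" "x \<le> y"
    then have "R x \<le> R y"
      by (intro mono_onD[OF R]) (simp_all add: n_def)
    with xy show "vec (Suc n) (\<lambda>i. if i < n then x $ i else of_bool (R x))
        \<le> vec (Suc n) (\<lambda>i. if i < n then y $ i else of_bool (R y))"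
      by (auto simp: less_eq_vec_def)
  qed
  ultimately show ?thesis
    using assms(1)
    by (auto simp: monotonic_gnn_def append_layer_def Let_def n_def le_Suc_eq mono_on_def)
qed

lemma gnn_lab_at_append_layer:
  assumes "l \<le> gnn_depth N"
  shows "gnn_lab_at (append_layer Q R N) l = gnn_lab_at N l"
  using assms
proof (induction l)
  case (Suc l)
  then show ?case
    by (intro ext) (simp add: gnn_layer_def nbr_labs_def append_layer_def Let_def)
qed (simp add: fun_eq_iff)

lemma computes_append_layer:
  fixes Qs :: "('v pointed \<Rightarrow> bool) list"
  assumes N: "computes d N Qs"
    and Q: "mono_on (carrier_vec (length Qs)) Q" and R: "mono_on (carrier_vec (Suc (length Qs))) R"
    and T: "\<And>p. p \<in> pointed_lgraphs d \<Longrightarrow>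
      R (truth_vec Qs p @\<^sub>v vec 1 (\<lambda>_. real (card {q \<in> nbrs p. Q (truth_vec Qs q)}))) \<longleftrightarrow> T p"
  shows "computes d (append_layer Q R N) (Qs @ [T])"
  unfolding computes_def
proof (intro conjI ballI)
  let ?L = "gnn_depth N" and ?N = "append_layer Q R N"
  have dim: "gnn_dim N ?L = length Qs"
    using N by (simp add: computes_def)
  have lab: "gnn_lab_at N ?L p = truth_vec Qs p" if "p \<in> pointed_lgraphs d" for p
    using N that by (simp add: computes_def)
  show "is_gnn d ?N" "monotonic_gnn ?N"
    using N Q R by (simp_all add: computes_def is_gnn_append_layer monotonic_append_layer)
  show "gnn_dim ?N (gnn_depth ?N) = length (Qs @ [T])"
    using N by (simp add: computes_def append_layer_def Let_def)
  fix p :: "'v pointed"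
  assume p: "p \<in> pointed_lgraphs d"
  have "nbr_labs N ?L p = image_mset (truth_vec Qs) (mset_set (nbrs p))"
    unfolding nbr_labs_def using nbrs_pointed_lgraphs[OF p] finite_nbrs[OF p] lab
    by (intro image_mset_cong) auto
  then have count: "size (filter_mset Q (nbr_labs N ?L p)) = card {q \<in> nbrs p. Q (truth_vec Qs q)}"
    using finite_nbrs[OF p] by (simp add: filter_mset_image_mset filter_mset_mset_set)
  let ?z = "truth_vec Qs p @\<^sub>v vec 1 (\<lambda>_. real (card {q \<in> nbrs p. Q (truth_vec Qs q)}))"
  have "gnn_lab_at ?N (Suc ?L) p = gnn_layer ?N (Suc ?L) (truth_vec Qs p) (nbr_labs N ?L p)"
    by (simp add: gnn_lab_at_append_layer lab[OF p] nbr_labs_def)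
  also have "\<dots> = vec (Suc (length Qs)) (\<lambda>i. if i < length Qs then ?z $ i else of_bool (R ?z))"
    by (simp add: gnn_layer_def append_layer_def Let_def dim count del: One_nat_def)
  also have "\<dots> = truth_vec (Qs @ [T]) p"
    unfolding T[OF p] by (intro eq_vecI) (auto simp: truth_vec_def nth_append less_Suc_eq)
  finally show "gnn_lab_at ?N (gnn_depth ?N) p = truth_vec (Qs @ [T]) p"
    by (simp add: append_layer_def Let_def)
qed

lemma mono_on_entry_ge:
  assumes "i < n"
  shows "mono_on (carrier_vec n) (\<lambda>x. (c :: real) \<le> x $ i)"
proof (rule mono_onI)
  fix x y :: "real vec"
  assume "y \<in> carrier_vec n" "x \<le> y"
  then have "x $ i \<le> y $ i"
    using assms by (simp add: less_eq_vec_def)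
  then show "(c \<le> x $ i) \<le> (c \<le> y $ i)"
    by auto
qed

lemma obtain_truth_vec_index:
  assumes "S \<in> set Qs"
  obtains i where "i < length Qs" and "\<And>p z. 1 \<le> (truth_vec Qs p @\<^sub>v z) $ i \<longleftrightarrow> S p"
    and "\<And>p. 1 \<le> truth_vec Qs p $ i \<longleftrightarrow> S p"
proof -
  obtain i where "i < length Qs" "Qs ! i = S"
    using assms by (auto simp: in_set_conv_nth)
  then show thesis
    by (intro that[of i]) (simp_all add: truth_vec_def)
qed

lemma computes_const:
  assumes "computes d N Qs"
  shows "\<exists>N'. computes d N' (Qs @ [\<lambda>p. b])"
proof (rule exI[of _ "append_layer (\<lambda>x. True) (\<lambda>z. b) N"], rule computes_append_layer[OF assms])
  show "mono_on (carrier_vec (length Qs)) (\<lambda>x :: real vec. True)"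
    "mono_on (carrier_vec (Suc (length Qs))) (\<lambda>z :: real vec. b)"
    by (simp_all add: mono_on_def)
qed simp

lemma computes_combine:
  assumes N: "computes d N Qs" and "S \<in> set Qs" and "T \<in> set Qs"
    and f: "\<And>a b a' b'. a \<le> a' \<Longrightarrow> b \<le> b' \<Longrightarrow> f a b \<le> f a' b'"
  shows "\<exists>N'. computes d N' (Qs @ [\<lambda>p. f (S p) (T p)])"
proof -
  obtain i where i: "i < length Qs" "\<And>p z. 1 \<le> (truth_vec Qs p @\<^sub>v z) $ i \<longleftrightarrow> S p"
    using obtain_truth_vec_index[OF \<open>S \<in> set Qs\<close>] by metis
  obtain j where j: "j < length Qs" "\<And>p z. 1 \<le> (truth_vec Qs p @\<^sub>v z) $ j \<longleftrightarrow> T p"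
    using obtain_truth_vec_index[OF \<open>T \<in> set Qs\<close>] by metis
  show ?thesis
  proof (rule exI[of _ "append_layer (\<lambda>x. True) (\<lambda>z. f (1 \<le> z $ i) (1 \<le> z $ j)) N"],
      rule computes_append_layer[OF N])
    show "mono_on (carrier_vec (length Qs)) (\<lambda>x :: real vec. True)"
      by (simp add: mono_on_def)
    show "mono_on (carrier_vec (Suc (length Qs))) (\<lambda>z :: real vec. f (1 \<le> z $ i) (1 \<le> z $ j))"
      using i(1) j(1) by (intro mono_onI f mono_onD[OF mono_on_entry_ge]) simp_all
  qed (simp add: i(2) j(2))
qed

lemma computes_Dia:
  assumes N: "computes d N Qs" and "holds_at \<phi> \<in> set Qs"
  shows "\<exists>N'. computes d N' (Qs @ [holds_at (Dia k \<phi>)])"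
proof -
  obtain i where i: "i < length Qs" "\<And>p. 1 \<le> truth_vec Qs p $ i \<longleftrightarrow> holds_at \<phi> p"
    using obtain_truth_vec_index[OF assms(2)] by metis
  show ?thesis
  proof (rule exI[of _ "append_layer (\<lambda>x. 1 \<le> x $ i) (\<lambda>z. real k \<le> z $ length Qs) N"],
      rule computes_append_layer[OF N])
    show "mono_on (carrier_vec (length Qs)) (\<lambda>x :: real vec. 1 \<le> x $ i)"
      using i(1) by (rule mono_on_entry_ge)
    show "mono_on (carrier_vec (Suc (length Qs))) (\<lambda>z :: real vec. real k \<le> z $ length Qs)"
      by (rule mono_on_entry_ge) simp
  qed (simp add: i(2) holds_at_Dia)
qed

definition atoms :: "nat \<Rightarrow> ('v pointed \<Rightarrow> bool) set" where
  "atoms d = (\<lambda>i. holds_at (Prop i)) ` {1..d}"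

text \<open>Extending an arbitrary computation, instead of constructing one network per formula,
  lets the induction on formulas proceed without composing networks in parallel.\<close>

definition addable :: "nat \<Rightarrow> ('v pointed \<Rightarrow> bool) \<Rightarrow> bool" where
  "addable d T \<longleftrightarrow> (\<forall>N Qs. computes d N Qs \<and> atoms d \<subseteq> set Qs \<longrightarrow>
     (\<exists>N' Rs. computes d N' (Qs @ Rs) \<and> T \<in> set (Qs @ Rs)))"

lemma ex_computes_superset:
  fixes \<T> :: "('v pointed \<Rightarrow> bool) set"
  assumes "finite \<T>" and "\<And>T. T \<in> \<T> \<Longrightarrow> addable d T"
    and "computes d N Qs" and "atoms d \<subseteq> set Qs"
  shows "\<exists>N' Rs. computes d N' (Qs @ Rs) \<and> \<T> \<subseteq> set (Qs @ Rs)"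
  using assms(1,2)
proof induction
  case empty
  show ?case
    using assms(3) by (intro exI[of _ N] exI[of _ "[]"]) simp
next
  case (insert T \<T>)
  then obtain N' Rs where "computes d N' (Qs @ Rs)" and \<T>: "\<T> \<subseteq> set (Qs @ Rs)"
    by auto
  moreover have "atoms d \<subseteq> set (Qs @ Rs)"
    using assms(4) by auto
  moreover have "addable d T"
    using insert.prems by simp
  ultimately obtain N'' Rs' where "computes d N'' ((Qs @ Rs) @ Rs')" "T \<in> set ((Qs @ Rs) @ Rs')"
    unfolding addable_def by blast
  with \<T> show ?case
    by (intro exI[of _ N''] exI[of _ "Rs @ Rs'"]) auto
qed

lemma addable_step:
  fixes \<T> :: "('v pointed \<Rightarrow> bool) set"
  assumes "finite \<T>" and "\<And>T. T \<in> \<T> \<Longrightarrow> addable d T"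
    and step: "\<And>N Qs. computes d N Qs \<Longrightarrow> \<T> \<subseteq> set Qs \<Longrightarrow> \<exists>N'. computes d N' (Qs @ [S])"
  shows "addable d S"
  unfolding addable_def
proof (intro allI impI)
  fix N and Qs :: "('v pointed \<Rightarrow> bool) list"
  assume "computes d N Qs \<and> atoms d \<subseteq> set Qs"
  then obtain N' Rs where "computes d N' (Qs @ Rs)" "\<T> \<subseteq> set (Qs @ Rs)"
    using ex_computes_superset[OF assms(1,2)] by metis
  then obtain N'' where "computes d N'' ((Qs @ Rs) @ [S])"
    using step by blast
  then show "\<exists>N' Rs. computes d N' (Qs @ Rs) \<and> S \<in> set (Qs @ Rs)"
    by (intro exI[of _ N''] exI[of _ "Rs @ [S]"]) simp
qed

lemma addable_const: "addable d (\<lambda>p. b)"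
  by (rule addable_step[of "{}"]) (simp_all add: computes_const)

lemma addable_combine:
  assumes "addable d S" and "addable d T"
    and "\<And>a b a' b'. a \<le> a' \<Longrightarrow> b \<le> b' \<Longrightarrow> f a b \<le> f a' b'"
  shows "addable d (\<lambda>p. f (S p) (T p))"
proof (rule addable_step)
  show "\<exists>N'. computes d N' (Qs @ [\<lambda>p. f (S p) (T p)])" if "computes d N Qs" "{S, T} \<subseteq> set Qs" for N Qs
    using that assms(3) by (intro computes_combine) auto
qed (use assms(1,2) in auto)

lemma addable_holds_at:
  assumes "\<phi> \<in> ex_pos_gml d"
  shows "addable d (holds_at \<phi> :: 'v pointed \<Rightarrow> bool)"
  using assms
proof (induction \<phi>)
  case (Prop i)
  then have "holds_at (Prop i) \<in> atoms d"
    by (simp add: atoms_def ex_pos_gml_def)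
  then show ?case
    unfolding addable_def by (metis append_Nil2 subsetD)
next
  case (Conj \<phi> \<psi>)
  then show ?case
    using addable_combine[of d "holds_at \<phi>" "holds_at \<psi>" "(\<and>)"]
    by (simp add: ex_pos_gml_def holds_at_def[abs_def])
next
  case (Disj \<phi> \<psi>)
  then show ?case
    using addable_combine[of d "holds_at \<phi>" "holds_at \<psi>" "(\<or>)"]
    by (simp add: ex_pos_gml_def holds_at_def[abs_def])
next
  case (Dia k \<phi>)
  show ?case
  proof (rule addable_step)
    show "addable d T" if "T \<in> {holds_at \<phi>}" for T :: "'v pointed \<Rightarrow> bool"
      using that Dia by (simp add: ex_pos_gml_def)
  qed (simp_all add: computes_Dia)
qed (simp_all add: ex_pos_gml_def holds_at_def[abs_def] addable_const)

lemma gnn_recognizable_if_computes: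
  assumes "computes d N Qs" and "T \<in> set Qs"
  shows "gnn_recognizable d T"
proof -
  obtain i where i: "i < length Qs" "\<And>p. 1 \<le> truth_vec Qs p $ i \<longleftrightarrow> T p"
    using obtain_truth_vec_index[OF assms(2)] by metis
  let ?N = "N\<lparr>gnn_cls := \<lambda>x. 1 \<le> x $ i\<rparr>"
  have lab: "gnn_lab_at ?N l = gnn_lab_at N l" for l
    by (induction l; rule ext) (simp_all add: gnn_layer_def nbr_labs_def)
  have "is_gnn d ?N"
    using assms(1) by (simp add: computes_def is_gnn_def)
  moreover have "monotonic_gnn ?N"
    using assms(1) mono_on_entry_ge[OF i(1)] by (simp add: computes_def monotonic_gnn_def)
  moreover have "gnn_run_at ?N p \<longleftrightarrow> T p" if "p \<in> pointed_lgraphs d" for p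
    using assms(1) that i(2) by (simp add: computes_def gnn_run_at_iff lab)
  ultimately show ?thesis
    unfolding gnn_recognizable_def by blast
qed

theorem definable_imp_gnn_recognizable:
  assumes "definable d Q"
  shows "gnn_recognizable d Q"
proof -
  obtain \<phi> where "\<phi> \<in> ex_pos_gml d" and \<phi>: "\<forall>p\<in>pointed_lgraphs d. Q p \<longleftrightarrow> holds_at \<phi> p"
    using assms unfolding definable_def by (elim bexE)
  then have "addable d (holds_at \<phi> :: 'a pointed \<Rightarrow> bool)"
    by (intro addable_holds_at)
  moreover have "atoms d \<subseteq> set (map (\<lambda>i. holds_at (Prop i)) [1..<Suc d])"
    by (auto simp: atoms_def)
  ultimately have "gnn_recognizable d (holds_at \<phi> :: 'a pointed \<Rightarrow> bool)"
    using computes_input_gnn gnn_recognizable_if_computes unfolding addable_def by blast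
  then show ?thesis
    using \<phi> by (simp add: gnn_recognizable_def)
qed

theorem theorem5p5:
  fixes d :: nat
  shows "(\<forall>N. is_gnn d N \<and> monotonic_gnn N \<longrightarrow>
            (\<exists>\<phi> \<in> ex_pos_gml d. \<forall>(G :: 'v lgraph) v. pointed_lgraph d G v \<longrightarrow>
               (gnn_run N G v \<longleftrightarrow> sat (kripke_of G) v \<phi>))) \<and>
         (\<forall>\<phi> \<in> ex_pos_gml d.
            (\<exists>N. is_gnn d N \<and> monotonic_gnn N \<and>
               (\<forall>(G :: 'v lgraph) v. pointed_lgraph d G v \<longrightarrow>
                  (gnn_run N G v \<longleftrightarrow> sat (kripke_of G) v \<phi>))))"
proof (intro conjI allI impI ballI)
  fix N
  assume "is_gnn d N \<and> monotonic_gnn N"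
  then have "definable d (gnn_run_at N :: 'v pointed \<Rightarrow> bool)"
    by (intro gnn_recognizable_imp_definable) (auto simp: gnn_recognizable_def)
  then show "\<exists>\<phi> \<in> ex_pos_gml d. \<forall>(G :: 'v lgraph) v. pointed_lgraph d G v \<longrightarrow>
      (gnn_run N G v \<longleftrightarrow> sat (kripke_of G) v \<phi>)"
    by (simp add: definable_def pointed_lgraphs_def gnn_run_at_def holds_at_def)
next
  fix \<phi>
  assume "\<phi> \<in> ex_pos_gml d"
  then have "gnn_recognizable d (holds_at \<phi> :: 'v pointed \<Rightarrow> bool)"
    by (intro definable_imp_gnn_recognizable) (auto intro: definableI)
  then show "\<exists>N. is_gnn d N \<and> monotonic_gnn N \<and> (\<forall>(G :: 'v lgraph) v. pointed_lgraph d G v \<longrightarrow>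
      (gnn_run N G v \<longleftrightarrow> sat (kripke_of G) v \<phi>))"
    by (simp add: gnn_recognizable_def pointed_lgraphs_def gnn_run_at_def holds_at_def)
qed

end
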